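(* Let $q\ge 2$ and $c\ge 1$ be integers and let $\kappa>0$. Consider a (symmetric) colluder strategy with parametrization $\Psi_b(\vec{x})$ that belongs to Class 2, i.e. there are real-valued functions $w$ and $W$ such that for every $b\in\{1,\dots,c\}$ and every $\vec{x}\in\mathbb{N}^{q-1}$ with $\sum_\beta x_\beta=c-b$, $$\Psi_b(\vec{x})=\frac{w(b)}{\ell+1}\prod_{k=1}^{r}W(b,z_k),$$ where $\ell$ is the number of entries of $\vec{x}$ equal to $b$, $r=q-1-\ell$, and $z_1,\dots,z_r$ are the entries of $\vec{x}$ different from $b$. Let $b\in\{1,\dots,c\}$, and let $N_b\in\mathbb{N}$ satisfy $N_b>\max\{c-b,\;|c-bq|,\;(c-b)(q-2)\}$. Let $\tau_b= e^{i2\pi/N_b}$, and for integers $a\in\{0,\dots,N_b-1\}$ let $$G_{ba}=\sum_{z\in\{0,\ldots,c-b\}\setminus\{b\}}\frac{\Gamma(\kappa+z)\,W(b,z)}{\tau_b^{az}\,z!},\qquad v_{ba}=\frac{\Gamma(\kappa+b)}{\tau_b^{ab}\,b!}.$$ Then $$K_b=\frac{b!\,(c-b)!\;w(b)}{q\,N_b\,\Gamma(\kappa+b)\,\Gamma(c-b+\kappa[q-1])\,B(\kappa\mathbf{1}_{q-1})}\sum_{a=0}^{N_b-1}\tau_b^{ac}\left[\left(G_{ba}+v_{ba}\right)^q-G_{ba}^{\,q}\right].$$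
   Context: $\mathbb{N}$ includes $0$. $\mathcal{Q}$ is an alphabet of size $q$, $c$ is the number of colluders, $\kappa>0$ is a constant. $\mathbf{1}_n=(1,\dots,1)$ has length $n$. For a vector $\vec{v}$ with $n\ge1$ positive entries the generalized Beta function is $B(\vec{v})=\prod_{a=1}^n\Gamma(v_a)\big/\Gamma\big(\sum_{a=1}^n v_a\big)$. For $\vec{x}\in\mathbb{N}^{q-1}$ with entries summing to $c-b$, $\binom{c-b}{\vec{x}}=(c-b)!/\prod_\beta x_\beta!$ is the multinomial coefficient. A colluder strategy is given by probabilities $\theta_{y|\vec{\sigma}}$ (with $\sum_{y\in\mathcal{Q}}\theta_{y|\vec\sigma}=1$) that the colluders output symbol $y\in\mathcal{Q}$, given the vector $\vec{\sigma}\in\mathbb{N}^{q}$ with $\sum_\alpha\sigma_\alpha=c$, where $\sigma_\alpha$ counts the colluders that received symbol $\alpha$; colluders can only output a symbol they received, i.e. $\theta_{y|\vec\sigma}=0$ if $\sigma_y=0$. The strategy is symbol-symmetric: $\theta_{\alpha|\vec\sigma}$ depends on $\alpha$ only through the value $\sigma_\alpha$, and is invariant under permutation of the other components of $\vec\sigma$. Hence one can define $\Psi_b(\vec{x})=\theta_{\alpha|\vec{\sigma}}$ where $\sigma_\alpha=b$ and $\vec{x}\in\mathbb{N}^{q-1}$ consists of the other components of $\vec\sigma$ (so the entries of $\vec{x}$ sum to $c-b$). The parameters $K_b$ are defined as $$K_b=\sum_{\vec{x}}\mathbb{P}_{q-1}(\vec{x}|b)\,\Psi_b(\vec{x}),\qquad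 \mathbb{P}_{q-1}(\vec{x}|b)=\binom{c-b}{\vec{x}}\frac{B(\kappa\mathbf{1}_{q-1}+\vec{x})}{B(\kappa\mathbf{1}_{q-1})},$$ where the sum is over all $\vec{x}\in\mathbb{N}^{q-1}$ whose entries sum to $c-b$. The function $W(b,z)$ is taken to be defined for all $z\in\{0,\dots,c-b\}\setminus\{b\}$. *)

theory Defs
  imports "HOL-Analysis.Analysis" "HOL-Library.Multiset"
begin

text \<open>
  The alphabet is a finite type \<open>'q\<close>, so that \<open>q = CARD('q)\<close>.  A tally
  \<open>\<sigma> :: 'q \<Rightarrow> nat\<close> counts the colluders that received each symbol, and \<open>\<theta> y \<sigma>\<close> is
  the probability of output \<open>y\<close> given \<open>\<sigma>\<close>; it is only constrained on tallies of total \<open>c\<close>.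
  Vectors of length \<open>q - 1\<close> are lists.
\<close>

definition colluder_strategy :: "nat \<Rightarrow> ('q::finite \<Rightarrow> ('q \<Rightarrow> nat) \<Rightarrow> real) \<Rightarrow> bool" where
  "colluder_strategy c \<theta> \<longleftrightarrow>
     (\<forall>\<sigma>. (\<Sum>\<alpha>\<in>UNIV. \<sigma> \<alpha>) = c \<longrightarrow>
        (\<forall>y. 0 \<le> \<theta> y \<sigma>) \<and> (\<Sum>y\<in>UNIV. \<theta> y \<sigma>) = 1 \<and> (\<forall>y. \<sigma> y = 0 \<longrightarrow> \<theta> y \<sigma> = 0))"

definition other_components :: "('q::finite \<Rightarrow> nat) \<Rightarrow> 'q \<Rightarrow> nat multiset" where
  "other_components \<sigma> \<alpha> = image_mset \<sigma> (mset_set (UNIV - {\<alpha>}))"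

text \<open>
  Symbol symmetry: \<open>\<theta> \<alpha> \<sigma>\<close> is determined by the number \<open>\<sigma> \<alpha>\<close> and by the remaining
  components up to reordering.
\<close>

definition symbol_symmetric :: "nat \<Rightarrow> ('q::finite \<Rightarrow> ('q \<Rightarrow> nat) \<Rightarrow> real) \<Rightarrow> bool" where
  "symbol_symmetric c \<theta> \<longleftrightarrow>
     (\<forall>\<alpha> \<alpha>' \<sigma> \<sigma>'. (\<Sum>\<beta>\<in>UNIV. \<sigma> \<beta>) = c \<longrightarrow> (\<Sum>\<beta>\<in>UNIV. \<sigma>' \<beta>) = c \<longrightarrow>
        \<sigma> \<alpha> = \<sigma>' \<alpha>' \<longrightarrow> other_components \<sigma> \<alpha> = other_components \<sigma>' \<alpha>' \<longrightarrow>
        \<theta> \<alpha> \<sigma> = \<theta> \<alpha>' \<sigma>')"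

text \<open>
  The common value of \<open>\<theta> \<alpha> \<sigma>\<close> over all \<open>\<alpha>\<close>, \<open>\<sigma>\<close> with \<open>\<sigma> \<alpha> = b\<close> whose other components
  are listed, in some order, by \<open>x\<close>; see \<open>Psi_eq\<close> for well-definedness.
\<close>

definition Psi :: "('q::finite \<Rightarrow> ('q \<Rightarrow> nat) \<Rightarrow> real) \<Rightarrow> nat \<Rightarrow> nat list \<Rightarrow> real" where
  "Psi \<theta> b x = (THE p. \<forall>\<alpha> \<sigma>. \<sigma> \<alpha> = b \<and> other_components \<sigma> \<alpha> = mset x \<longrightarrow> \<theta> \<alpha> \<sigma> = p)"

lemma sum_eq_other_components:
  "(\<Sum>\<beta>\<in>UNIV. \<sigma> \<beta>) = \<sigma> \<alpha> + sum_mset (other_components \<sigma> \<alpha>)"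
  unfolding other_components_def
  by (subst sum.remove[of _ \<alpha>]) (simp_all add: sum_unfold_sum_mset)

lemma Psi_eq:
  assumes "symbol_symmetric c \<theta>" "(\<Sum>\<beta>\<in>UNIV. \<sigma> \<beta>) = c" "other_components \<sigma> \<alpha> = mset x"
  shows "Psi \<theta> (\<sigma> \<alpha>) x = \<theta> \<alpha> \<sigma>"
  unfolding Psi_def
proof (rule the_equality)
  show "\<forall>\<alpha>' \<sigma>'. \<sigma>' \<alpha>' = \<sigma> \<alpha> \<and> other_components \<sigma>' \<alpha>' = mset x \<longrightarrow> \<theta> \<alpha>' \<sigma>' = \<theta> \<alpha> \<sigma>"
  proof (intro allI impI, elim conjE)
    fix \<alpha>' :: 'a and \<sigma>' :: "'a \<Rightarrow> nat"
    assume eq: "\<sigma>' \<alpha>' = \<sigma> \<alpha>" "other_components \<sigma>' \<alpha>' = mset x"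
    have "(\<Sum>\<beta>\<in>UNIV. \<sigma>' \<beta>) = c"
      using sum_eq_other_components[of \<sigma>' \<alpha>'] sum_eq_other_components[of \<sigma> \<alpha>] eq assms by simp
    then show "\<theta> \<alpha>' \<sigma>' = \<theta> \<alpha> \<sigma>"
      using assms eq unfolding symbol_symmetric_def by metis
  qed
qed (use assms(3) in blast)

definition compositions :: "nat \<Rightarrow> nat \<Rightarrow> nat list set" where
  "compositions k n = {x. length x = k \<and> sum_list x = n}"

definition gen_Beta :: "real list \<Rightarrow> real" where
  "gen_Beta v = prod_list (map Gamma v) / Gamma (sum_list v)"

definition multinomial :: "nat \<Rightarrow> nat list \<Rightarrow> real" where
  "multinomial n x = fact n / prod_list (map fact x)"

text \<open>The probability of \<open>x\<close> given \<open>b\<close>; here \<open>q - 1 = length x\<close>.\<close>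

definition tally_prob :: "real \<Rightarrow> nat \<Rightarrow> nat \<Rightarrow> nat list \<Rightarrow> real" where
  "tally_prob \<kappa> c b x =
     multinomial (c - b) x *
     (gen_Beta (map (\<lambda>n. \<kappa> + real n) x) / gen_Beta (replicate (length x) \<kappa>))"

definition K_param :: "real \<Rightarrow> nat \<Rightarrow> ('q::finite \<Rightarrow> ('q \<Rightarrow> nat) \<Rightarrow> real) \<Rightarrow> nat \<Rightarrow> real" where
  "K_param \<kappa> c \<theta> b =
     (\<Sum>x\<in>compositions (CARD('q) - 1) (c - b). tally_prob \<kappa> c b x * Psi \<theta> b x)"

definition class2 ::
  "nat \<Rightarrow> ('q::finite \<Rightarrow> ('q \<Rightarrow> nat) \<Rightarrow> real) \<Rightarrow> (nat \<Rightarrow> real) \<Rightarrow> (nat \<Rightarrow> nat \<Rightarrow> real) \<Rightarrow> bool" where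
  "class2 c \<theta> w W \<longleftrightarrow>
     (\<forall>b\<in>{1..c}. \<forall>x\<in>compositions (CARD('q) - 1) (c - b).
        Psi \<theta> b x =
          w b / (real (count_list x b) + 1) * prod_list (map (W b) (filter (\<lambda>z. z \<noteq> b) x)))"

end

theory Submission
  imports Defs
begin

text \<open>
  The generating-function proof: in \<open>(G + v)\<^sup>q - G\<^sup>q\<close> the term with \<open>v\<close> to the power \<open>l + 1\<close> carries
  the coefficient \<open>q/(l + 1)\<close> times the binomial coefficient \<open>q - 1\<close> over \<open>l\<close>.  Expanding it
  as a sum over lists \<open>x\<close> of length \<open>q - 1\<close> in which \<open>b\<close> occurs \<open>l\<close> times reproduces the
  class 2 factor \<open>1/(l + 1)\<close>.  The sum over \<open>a\<close> is a discrete Fourier transform: it extracts the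
  lists with \<open>b + sum_list x\<close> congruent to \<open>c\<close> modulo \<open>N\<close>, and the lower bound on \<open>N\<close>
  excludes all such lists except those with \<open>sum_list x = c - b\<close>.
\<close>

lemma sum_lists_length_Suc:
  fixes f :: "'a list \<Rightarrow> 'b::comm_monoid_add"
  assumes "finite A"
  shows "(\<Sum>x | set x \<subseteq> A \<and> length x = Suc n. f x) =
    (\<Sum>z\<in>A. \<Sum>x | set x \<subseteq> A \<and> length x = n. f (z # x))"
proof -
  let ?L = "{x. set x \<subseteq> A \<and> length x = n}"
  have "{x. set x \<subseteq> A \<and> length x = Suc n} = (\<lambda>(z, x). z # x) ` (A \<times> ?L)"
    by (auto simp: image_iff length_Suc_conv)
  moreover have "inj_on (\<lambda>(z, x). z # x) (A \<times> ?L)"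
    by (auto simp: inj_on_def)
  ultimately show ?thesis
    by (simp add: sum.reindex sum.cartesian_product split_def)
qed

text \<open>Choose the \<open>l\<close> positions holding \<open>b\<close>; each of the other
  \<open>n - l\<close> positions then ranges freely over \<open>S\<close> and contributes a factor
  \<open>sum g S\<close>. The weight \<open>F\<close> is kept arbitrary because the induction splits
  off the head: a head \<open>b\<close> replaces \<open>F\<close> by its shift, a head in
  \<open>S\<close> gives a factor \<open>sum g S\<close>, and Pascal's rule joins the two
  sums.\<close>

lemma sum_lists_count_list:
  fixes F :: "nat \<Rightarrow> 'b::comm_semiring_1"
  assumes "finite S" "b \<notin> S"
  shows "(\<Sum>x | set x \<subseteq> insert b S \<and> length x = n.
            F (count_list x b) * prod_list (map g (filter (\<lambda>z. z \<noteq> b) x))) =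
         (\<Sum>l\<le>n. of_nat (n choose l) * F l * sum g S ^ (n - l))"
proof (induction n arbitrary: F)
  case 0
  have "{x. set x \<subseteq> insert b S \<and> length x = 0} = {[]}"
    by auto
  then show ?case
    by simp
next
  case (Suc n)
  let ?L = "{x. set x \<subseteq> insert b S \<and> length x = n}"
  let ?p = "\<lambda>x. prod_list (map g (filter (\<lambda>z. z \<noteq> b) x))"
  let ?G = "sum g S"
  have "(\<Sum>x | set x \<subseteq> insert b S \<and> length x = Suc n. F (count_list x b) * ?p x) =
      (\<Sum>x\<in>?L. F (Suc (count_list x b)) * ?p x) +
      (\<Sum>z\<in>S. \<Sum>x\<in>?L. F (count_list (z # x) b) * ?p (z # x))"
    using assms by (simp add: sum_lists_length_Suc)
  also have "(\<Sum>z\<in>S. \<Sum>x\<in>?L. F (count_list (z # x) b) * ?p (z # x)) =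
      (\<Sum>z\<in>S. g z * (\<Sum>x\<in>?L. F (count_list x b) * ?p x))"
    unfolding sum_distrib_left using assms(2)
    by (intro sum.cong refl) (auto simp: mult_ac)
  also have "\<dots> = ?G * (\<Sum>x\<in>?L. F (count_list x b) * ?p x)"
    by (simp add: sum_distrib_right)
  also have "(\<Sum>x\<in>?L. F (count_list x b) * ?p x) =
      (\<Sum>l\<le>n. of_nat (n choose l) * F l * ?G ^ (n - l))"
    by (rule Suc.IH)
  also have "(\<Sum>x\<in>?L. F (Suc (count_list x b)) * ?p x) =
      (\<Sum>l\<le>n. of_nat (n choose l) * F (Suc l) * ?G ^ (n - l))"
    by (rule Suc.IH)
  also have "?G * (\<Sum>l\<le>n. of_nat (n choose l) * F l * ?G ^ (n - l)) =
      (\<Sum>l\<le>n. of_nat (n choose l) * F l * ?G ^ (Suc n - l))"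
    unfolding sum_distrib_left
    by (intro sum.cong refl) (auto simp: Suc_diff_le mult_ac)
  \<comment> \<open>The added term \<open>l = Suc n\<close> has binomial coefficient zero. With it,
    splitting off \<open>l = 0\<close> and shifting leaves the same index range as in the sum for
    heads \<open>b\<close>.\<close>
  also have "\<dots> = (\<Sum>l\<le>Suc n. of_nat (n choose l) * F l * ?G ^ (Suc n - l))"
    by (simp add: binomial_eq_0)
  also have "\<dots> = F 0 * ?G ^ Suc n +
      (\<Sum>l\<le>n. of_nat (n choose Suc l) * F (Suc l) * ?G ^ (n - l))"
    by (subst sum.atMost_Suc_shift) simp
  finally show ?case
    by (subst sum.atMost_Suc_shift)
      (simp add: sum.distrib [symmetric] algebra_simps)
qed

text \<open>The term without \<open>v\<close> cancels, and the absorption identity for binomial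
  coefficients turns row \<open>Suc n\<close> into row \<open>n\<close> at the price of
  \<open>Suc n\<close> over \<open>Suc l\<close>. The sum then has the shape of
  \<open>sum_lists_count_list\<close>, with \<open>F l\<close> equal to
  \<open>v ^ Suc l / of_nat (Suc l)\<close>.\<close>

lemma power_add_diff_power:
  fixes G v :: "'a::field_char_0"
  shows "(G + v) ^ Suc n - G ^ Suc n =
    of_nat (Suc n) * (\<Sum>l\<le>n. of_nat (n choose l) * (v ^ Suc l / of_nat (Suc l)) * G ^ (n - l))"
proof -
  have "(G + v) ^ Suc n = (\<Sum>l\<le>Suc n. of_nat (Suc n choose l) * v ^ l * G ^ (Suc n - l))"
    by (metis add.commute binomial_ring)
  also have "\<dots> = G ^ Suc n + (\<Sum>l\<le>n. of_nat (Suc n choose Suc l) * v ^ Suc l * G ^ (n - l))"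
    by (subst sum.atMost_Suc_shift) simp
  also have "(\<Sum>l\<le>n. of_nat (Suc n choose Suc l) * v ^ Suc l * G ^ (n - l)) =
      of_nat (Suc n) * (\<Sum>l\<le>n. of_nat (n choose l) * (v ^ Suc l / of_nat (Suc l)) * G ^ (n - l))"
    unfolding sum_distrib_left
  proof (intro sum.cong refl)
    fix l
    have "of_nat (Suc l) * of_nat (Suc n choose Suc l) = (of_nat (Suc n) * of_nat (n choose l) :: 'a)"
      using Suc_times_binomial_eq[of n l] by (metis mult.commute of_nat_mult)
    then have "of_nat (Suc n choose Suc l) = of_nat (Suc n) * of_nat (n choose l) / (of_nat (Suc l) :: 'a)"
      by (metis nonzero_mult_div_cancel_left of_nat_neq_0)
    then show "of_nat (Suc n choose Suc l) * v ^ Suc l * G ^ (n - l) =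
        of_nat (Suc n) * (of_nat (n choose l) * (v ^ Suc l / of_nat (Suc l)) * G ^ (n - l))"
      by (simp only: times_divide_eq_left times_divide_eq_right mult_ac)
  qed
  finally show ?thesis
    by simp
qed

text \<open>The summands are powers of an \<open>N\<close>-th root of unity \<open>\<rho>\<close>,
  so the geometric sum vanishes unless \<open>\<rho> = 1\<close>. That case means \<open>s\<close>
  and \<open>t\<close> agree modulo \<open>N\<close>, which the bound on their distance sharpens to
  equality.\<close>

lemma sum_root_of_unity_ratio:
  fixes N s t :: nat
  defines "\<tau> \<equiv> exp (\<i> * 2 * of_real pi / of_nat N)"
  assumes "N > 0" and "\<bar>int s - int t\<bar> < int N"
  shows "(\<Sum>a<N. \<tau> ^ (a * s) / \<tau> ^ (a * t)) = (if s = t then of_nat N else 0)"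
proof -
  have \<tau>_power: "\<tau> ^ j = exp (2 * of_real pi * \<i> * of_nat j / of_nat N)" for j
    unfolding \<tau>_def by (simp add: exp_of_nat_mult [symmetric] mult_ac)
  have \<tau>_nz: "\<tau> \<noteq> 0"
    by (simp add: \<tau>_def)
  have \<tau>_N: "\<tau> ^ N = 1"
    using \<open>N > 0\<close> by (simp add: \<tau>_power)
  define \<rho> where "\<rho> = \<tau> ^ s / \<tau> ^ t"
  have ratio: "\<tau> ^ (a * s) / \<tau> ^ (a * t) = \<rho> ^ a" for a
    by (simp add: \<rho>_def power_divide power_mult [symmetric] mult.commute)
  have \<rho>_N: "\<rho> ^ N = 1"
    by (metis ratio \<tau>_N power_mult power_one div_by_1)
  show ?thesis
  proof (cases "s = t")
    case True
    then show ?thesis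
      using \<tau>_nz by simp
  next
    case False
    have "\<rho> \<noteq> 1"
    proof
      assume "\<rho> = 1"
      then have "\<tau> ^ s = \<tau> ^ t"
        using \<tau>_nz by (simp add: \<rho>_def)
      then have "s mod N = t mod N"
        using \<open>N > 0\<close> complex_root_unity_eq[of N s t] by (simp add: \<tau>_power)
      then have "int N dvd int s - int t"
        by (metis mod_eq_dvd_iff zmod_int)
      then show False
        using assms(3) False zdvd_imp_le[of "int N" "\<bar>int s - int t\<bar>"] by auto
    qed
    then have "(\<Sum>a<N. \<rho> ^ a) = 0"
      using \<rho>_N by (simp add: geometric_sum)
    then show ?thesis
      using False by (simp add: ratio)
  qed
qed

lemma sum_list_le_length_mult:
  fixes m :: nat
  assumes "\<And>z. z \<in> set x \<Longrightarrow> z \<le> m"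
  shows "sum_list x \<le> length x * m"
  using assms by (induction x) (auto intro: add_mono)

text \<open>Every entry \<open>z\<close>, equal to \<open>b\<close> or not, brings
  \<open>H z\<close> and a denominator \<open>t ^ z\<close>, so the denominators collect to
  \<open>t ^ sum_list x\<close>; \<open>W\<close> enters only through the entries different from
  \<open>b\<close>.\<close>

lemma prod_list_map_mult_split:
  fixes H W :: "nat \<Rightarrow> 'a::field"
  shows "(H b / t ^ b) ^ count_list x b *
      prod_list (map (\<lambda>z. H z * W z / t ^ z) (filter (\<lambda>z. z \<noteq> b) x)) =
    prod_list (map H x) * prod_list (map W (filter (\<lambda>z. z \<noteq> b) x)) / t ^ sum_list x"
proof (induction x)
  case (Cons z x)
  let ?f = "\<lambda>z. H z * W z / t ^ z" and ?h = "H b / t ^ b"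
  have "?h ^ count_list (z # x) b * prod_list (map ?f (filter (\<lambda>z. z \<noteq> b) (z # x))) =
      (if z = b then ?h else ?f z) *
      (?h ^ count_list x b * prod_list (map ?f (filter (\<lambda>z. z \<noteq> b) x)))"
    by (simp add: mult_ac)
  then show ?case
    unfolding Cons.IH by (cases "z = b") (simp_all add: power_add)
qed simp

lemma prod_list_map_of_real:
  "prod_list (map (\<lambda>z. of_real (f z) :: 'a::real_field) x) = of_real (prod_list (map f x))"
  by (induction x) auto

text \<open>The factorials of the multinomial coefficient merge entrywise with the Gamma values in
  the numerator of \<open>gen_Beta\<close>. What remains depends on \<open>x\<close> only through
  its length and sum, hence is constant on a set of compositions.\<close>

lemma tally_prob_altdef:
  "tally_prob \<kappa> c b x =
     fact (c - b) * prod_list (map (\<lambda>z. Gamma (\<kappa> + real z) / fact z) x) /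
     (Gamma (\<kappa> * real (length x) + real (sum_list x)) * gen_Beta (replicate (length x) \<kappa>))"
proof -
  have "sum_list (map (\<lambda>n. \<kappa> + real n) x) = \<kappa> * real (length x) + real (sum_list x)"
    by (induction x) (auto simp: algebra_simps)
  moreover have "prod_list (map (\<lambda>z. Gamma (\<kappa> + real z) / fact z) x) =
      prod_list (map Gamma (map (\<lambda>n. \<kappa> + real n) x)) / prod_list (map fact x)"
    by (induction x) auto
  moreover have "real (prod_list (map fact x)) = prod_list (map fact x)"
    by (induction x) auto
  ultimately show ?thesis
    by (simp add: tally_prob_def multinomial_def gen_Beta_def)
qed

theorem theorem2:
  fixes \<theta> :: "'q::finite \<Rightarrow> ('q \<Rightarrow> nat) \<Rightarrow> real"
    and q c b N :: nat and \<kappa> :: real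
    and w :: "nat \<Rightarrow> real" and W :: "nat \<Rightarrow> nat \<Rightarrow> real"
    and \<tau> :: complex and G v :: "nat \<Rightarrow> complex"
  assumes "CARD('q) = q" and "q \<ge> 2" and "c \<ge> 1" and "\<kappa> > 0"
    and "colluder_strategy c \<theta>" and "symbol_symmetric c \<theta>"
    and "class2 c \<theta> w W"
    and "b \<in> {1..c}"
    and "int N > Max {int c - int b, \<bar>int c - int b * int q\<bar>, (int c - int b) * (int q - 2)}"
    and "\<tau> = exp (\<i> * 2 * of_real pi / of_nat N)"
    and "\<And>a. a \<in> {0..N-1} \<Longrightarrow>
           G a = (\<Sum>z\<in>{0..c-b} - {b}.
                    of_real (Gamma (\<kappa> + real z) * W b z) / (\<tau> ^ (a * z) * fact z))"
    and "\<And>a. a \<in> {0..N-1} \<Longrightarrow>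
           v a = of_real (Gamma (\<kappa> + real b)) / (\<tau> ^ (a * b) * fact b)"
  shows "complex_of_real (K_param \<kappa> c \<theta> b) =
           of_real (fact b * fact (c - b) * w b /
             (real q * real N * Gamma (\<kappa> + real b) *
              Gamma (real (c - b) + \<kappa> * real (q - 1)) *
              gen_Beta (replicate (q - 1) \<kappa>))) *
           (\<Sum>a = 0..N-1. \<tau> ^ (a * c) * ((G a + v a) ^ q - G a ^ q))"
proof -
  define n where "n = q - 1"
  define M where "M = c - b"
  define S where "S = {0..M} - {b}"
  define L where "L = {x. set x \<subseteq> insert b S \<and> length x = n}"
  define H where "H z = Gamma (\<kappa> + real z) / fact z" for z :: nat
  \<comment> \<open>\<open>T x\<close> is the part of a summand of \<open>K_param\<close> that
    varies with \<open>x\<close>; the constant part is \<open>fact M * w b / D\<close> with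
    \<open>D\<close> introduced below.\<close>
  define T where "T x = prod_list (map H x) * prod_list (map (W b) (filter (\<lambda>z. z \<noteq> b) x)) /
    (real (count_list x b) + 1)" for x
  have q: "q = Suc n"
    using assms(2) by (simp add: n_def)
  have b: "1 \<le> b" "b \<le> c" and c: "c = M + b"
    using assms(8) by (auto simp: M_def)
  have S: "finite S" "b \<notin> S"
    by (auto simp: S_def)
  have "finite L"
    unfolding L_def by (rule finite_lists_length_eq) (simp add: S)
  have N_bounds: "int M < int N" "int b * int q - int c < int N" "int M * (int q - 2) < int N"
    using assms(9) b by (auto simp: M_def of_nat_diff)
  then have "N > 0"
    by linarith
  have \<tau>_nz: "\<tau> \<noteq> 0"
    by (simp add: assms(10))

  have fourier: "(\<Sum>a<N. \<tau> ^ (a * c) / \<tau> ^ (a * (b + sum_list x))) =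
      (if sum_list x = M then of_nat N else 0)" if "x \<in> L" for x
  proof -
    \<comment> \<open>The maximum is needed since \<open>b\<close> may exceed \<open>M\<close> and
      still occur as an entry. After subtracting \<open>M\<close>, the case \<open>b\<close> gives
      \<open>b * q - c\<close> and the case \<open>M\<close> gives \<open>M * (q - 2)\<close>, both
      bounded by \<open>N\<close>.\<close>
    have "sum_list x \<le> n * max b M"
      using that sum_list_le_length_mult[of x "max b M"] by (force simp: L_def S_def)
    then have "int (sum_list x) \<le> int n * int (max b M)"
      by (metis of_nat_mono of_nat_mult)
    moreover have "int n * int b - int M < int N" "int n * int M - int M < int N"
      using N_bounds(2,3) by (simp_all add: q c algebra_simps)
    ultimately have "int (sum_list x) - int M < int N"
      by (cases "b \<le> M") auto
    then have "\<bar>int c - int (b + sum_list x)\<bar> < int N"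
      using N_bounds(1) by (simp add: c)
    from sum_root_of_unity_ratio[OF \<open>N > 0\<close> this] show ?thesis
      by (auto simp: c assms(10))
  qed

  have expand: "(G a + v a) ^ q - G a ^ q =
      of_nat q * of_real (H b) * (\<Sum>x\<in>L. of_real (T x) / \<tau> ^ (a * (b + sum_list x)))"
    if "a < N" for a
  proof -
    define t where "t = \<tau> ^ a"
    define g :: "nat \<Rightarrow> complex" where "g z = of_real (H z) * of_real (W b z) / t ^ z" for z
    have a: "a \<in> {0..N-1}"
      using that by auto
    have G: "G a = sum g S"
      unfolding assms(11)[OF a] g_def S_def M_def H_def t_def
      by (intro sum.cong refl) (simp add: power_mult [symmetric] mult.commute)
    have v: "v a = of_real (H b) / t ^ b"
      unfolding assms(12)[OF a] H_def t_def
      by (simp add: power_mult [symmetric] mult.commute)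
    have "(G a + v a) ^ q - G a ^ q = of_nat q *
        (\<Sum>l\<le>n. of_nat (n choose l) * (v a ^ Suc l / of_nat (Suc l)) * sum g S ^ (n - l))"
      unfolding q power_add_diff_power by (simp add: G)
    also have "(\<Sum>l\<le>n. of_nat (n choose l) * (v a ^ Suc l / of_nat (Suc l)) * sum g S ^ (n - l)) =
        (\<Sum>x\<in>L. v a ^ Suc (count_list x b) / of_nat (Suc (count_list x b)) *
          prod_list (map g (filter (\<lambda>z. z \<noteq> b) x)))"
      unfolding L_def by (rule sum_lists_count_list [OF S, symmetric])
    also have "\<dots> = (\<Sum>x\<in>L. of_real (H b) * (of_real (T x) / \<tau> ^ (a * (b + sum_list x))))"
    proof (intro sum.cong refl)
      fix x
      \<comment> \<open>One factor \<open>v a\<close> is set aside: it supplies \<open>H b\<close>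
        and the summand \<open>b\<close> in the exponent of \<open>t\<close>. The remaining copies
        match the entries of \<open>x\<close> equal to \<open>b\<close>.\<close>
      have "v a ^ Suc (count_list x b) / of_nat (Suc (count_list x b)) *
            prod_list (map g (filter (\<lambda>z. z \<noteq> b) x)) =
          v a / of_nat (Suc (count_list x b)) *
            (v a ^ count_list x b * prod_list (map g (filter (\<lambda>z. z \<noteq> b) x)))"
        by simp
      also have "v a ^ count_list x b * prod_list (map g (filter (\<lambda>z. z \<noteq> b) x)) =
          of_real (prod_list (map H x) * prod_list (map (W b) (filter (\<lambda>z. z \<noteq> b) x))) /
            t ^ sum_list x"
        unfolding v g_def
        by (subst prod_list_map_mult_split) (simp add: prod_list_map_of_real)
      also have "v a / of_nat (Suc (count_list x b)) * \<dots> =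
          of_real (H b) * (of_real (T x) / t ^ (b + sum_list x))"
        by (simp add: v T_def power_add add.commute)
      finally show "v a ^ Suc (count_list x b) / of_nat (Suc (count_list x b)) *
            prod_list (map g (filter (\<lambda>z. z \<noteq> b) x)) =
          of_real (H b) * (of_real (T x) / \<tau> ^ (a * (b + sum_list x)))"
        by (simp add: t_def power_mult)
    qed
    finally show ?thesis
      by (simp add: sum_distrib_left mult.assoc)
  qed

  \<comment> \<open>An entry of a list with sum \<open>M\<close> is at most \<open>M\<close>, so
    every composition of \<open>M\<close> already has its entries in
    \<open>insert b S\<close>.\<close>
  have comps: "{x \<in> L. sum_list x = M} = compositions n M"
    using member_le_sum_list by (fastforce simp: compositions_def L_def S_def)
  have "{0..N-1} = {..<N}"
    using \<open>N > 0\<close> by auto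
  then have "(\<Sum>a = 0..N-1. \<tau> ^ (a * c) * ((G a + v a) ^ q - G a ^ q)) =
      (\<Sum>a<N. of_nat q * of_real (H b) *
        (\<Sum>x\<in>L. of_real (T x) * (\<tau> ^ (a * c) / \<tau> ^ (a * (b + sum_list x)))))"
    by (simp add: expand sum_distrib_left mult_ac)
  also have "\<dots> = of_nat q * of_real (H b) *
      (\<Sum>x\<in>L. of_real (T x) * (\<Sum>a<N. \<tau> ^ (a * c) / \<tau> ^ (a * (b + sum_list x))))"
    by (subst sum_distrib_left [symmetric], subst sum.swap) (simp add: sum_distrib_left)
  also have "(\<Sum>x\<in>L. of_real (T x) * (\<Sum>a<N. \<tau> ^ (a * c) / \<tau> ^ (a * (b + sum_list x)))) =
      (\<Sum>x\<in>L. if sum_list x = M then of_real (T x) * of_nat N else 0)"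
    by (intro sum.cong refl) (simp add: fourier)
  also have "\<dots> = of_nat N * (\<Sum>x\<in>compositions n M. of_real (T x))"
    using \<open>finite L\<close> by (simp add: sum.inter_filter [symmetric] comps sum_distrib_left mult.commute)
  finally have rhs: "(\<Sum>a = 0..N-1. \<tau> ^ (a * c) * ((G a + v a) ^ q - G a ^ q)) =
      of_real (real q * real N * H b * (\<Sum>x\<in>compositions n M. T x))"
    by simp

  define D where "D = Gamma (real M + \<kappa> * real n) * gen_Beta (replicate n \<kappa>)"
  have "K_param \<kappa> c \<theta> b = (\<Sum>x\<in>compositions n M. fact M * w b / D * T x)"
    unfolding K_param_def assms(1) n_def [symmetric] M_def [symmetric]
  proof (intro sum.cong refl)
    fix x
    assume x: "x \<in> compositions n M"
    have "Psi \<theta> b x =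
        w b / (real (count_list x b) + 1) * prod_list (map (W b) (filter (\<lambda>z. z \<noteq> b) x))"
      using assms(7,8) x unfolding class2_def assms(1) n_def [symmetric] by (auto simp: M_def)
    moreover have "tally_prob \<kappa> c b x = fact M * prod_list (map H x) / D"
      using x by (simp add: tally_prob_altdef H_def [abs_def] D_def M_def compositions_def add.commute)
    ultimately show "tally_prob \<kappa> c b x * Psi \<theta> b x = fact M * w b / D * T x"
      by (simp add: T_def)
  qed
  then have K: "K_param \<kappa> c \<theta> b = fact M * w b / D * (\<Sum>x\<in>compositions n M. T x)"
    by (simp add: sum_distrib_left)
  \<comment> \<open>Positivity permits cancelling the factor \<open>H b\<close> from
    \<open>rhs\<close> against \<open>fact b / Gamma (\<kappa> + real b)\<close> in the claimed
    prefactor.\<close>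
  have "Gamma (\<kappa> + real b) > 0"
    using assms(4) by (intro Gamma_real_pos) simp
  then have "fact b * fact M * w b /
        (real q * real N * Gamma (\<kappa> + real b) * Gamma (real M + \<kappa> * real n) *
          gen_Beta (replicate n \<kappa>)) * (real q * real N * H b) = fact M * w b / D"
    using \<open>N > 0\<close> assms(2) by (simp add: H_def D_def)
  then show ?thesis
    unfolding rhs n_def [symmetric] M_def [symmetric] of_real_mult [symmetric] K
    by (simp only: mult.assoc [symmetric])
qed

end
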